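(* Let $p$ be an odd prime. Then $$\sum_{k=0}^{p-1}\frac{3k+1}{(-16)^k}\binom{2k}{k} f_k \equiv p\,(-1)^{\frac{p-1}{2}} \pmod{p^3}.$$
   Context: The Franel numbers are defined by $f_n=\sum_{k=0}^n \binom{n}{k}^3$ for integers $n\ge 0$. The left-hand side is a rational number whose denominator is a power of $2$, hence coprime to $p$; a congruence $a\equiv b \pmod{p^r}$ between such rationals means that $a-b$ is a rational number whose numerator (in lowest terms) is divisible by $p^r$ and whose denominator is coprime to $p$. *)

theory Defs
  imports Complex_Main "HOL-Computational_Algebra.Primes"
begin

definition franel :: "nat \<Rightarrow> nat" where
  "franel n = (\<Sum>k\<le>n. (n choose k) ^ 3)"

definition rat_cong :: "rat \<Rightarrow> rat \<Rightarrow> nat \<Rightarrow> nat \<Rightarrow> bool" where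
  "rat_cong a b p r \<longleftrightarrow>
     (\<exists>x::rat. a - b = of_nat (p ^ r) * x \<and> coprime (snd (quotient_of x)) (int p))"

end

theory Submission
  imports Defs
begin

text \<open>
  The starting point is \<open>f\<^sub>n = (\<Sum>j. h n j)\<close> with \<open>h n j = (n+2j)! / ((n-j)! j!\<^sup>3) (-4)\<^bsup>n-j\<^esup>\<close>; both sides satisfy
  Franel's three-term recurrence, as telescoping certificates show. For fixed \<open>j\<close> the sum of
  \<open>(3k+1) (2k choose k) h k j / (-16)\<^sup>k\<close> over \<open>k < p\<close> is Gosper summable, which turns the left-hand side
  into a single sum over \<open>j < p\<close>. With \<open>m = (p-1)/2\<close>, the terms \<open>j > m\<close> vanish modulo \<open>p\<^sup>3\<close>, the terms
  \<open>j < m\<close> are \<open>p\<^sup>2 (-1)\<^sup>j (m choose j) / (2j+1)\<close>, whose sum is known in closed form by partial fractions,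
  and the term \<open>j = m\<close> is explicit. If \<open>c = (-1)\<^sup>m (2m choose m)\<close> and \<open>s = c / 4\<^sup>m\<close>, the total is
  \<open>p (-1)\<^sup>m (s\<^sup>3/c + 1/s - 1)\<close>; since \<open>s\<^sup>2 \<equiv> c\<close> modulo \<open>p\<^sup>2\<close>, the bracket is \<open>1 + (s-1)\<^sup>2/s\<close> modulo \<open>p\<^sup>2\<close>,
  and \<open>s \<equiv> 1\<close> modulo \<open>p\<close>.
\<close>

section \<open>A single-sum formula for the Franel numbers\<close>

text \<open>The closed form \<open>(n+2j)! / ((n-j)! j!\<^sup>3) (-4)\<^bsup>n-j\<^esup>\<close>, given by its ratio in \<open>j\<close> so that it
  vanishes for \<open>j > n\<close> without truncated subtraction.\<close>

primrec macmahon_term :: "nat \<Rightarrow> nat \<Rightarrow> rat" where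
  "macmahon_term n 0 = (-4) ^ n"
| "macmahon_term n (Suc j) =
     macmahon_term n j * ((of_nat n + 2 * of_nat j + 1) * (of_nat n + 2 * of_nat j + 2) *
       (of_nat n - of_nat j)) / (-4 * (of_nat j + 1) ^ 3)"

lemma macmahon_term_eq_0: "n < j \<Longrightarrow> macmahon_term n j = 0"
proof (induction j)
  case (Suc j)
  then show ?case by (cases "n = j") auto
qed simp

text \<open>The ratio in \<open>n\<close>, by induction on \<open>j\<close> because only the ratio
  in \<open>j\<close> is built in. It stays cross-multiplied: at \<open>j = n + 1\<close> both sides
  are zero although \<open>macmahon_term (n + 1) (n + 1)\<close> is not.\<close>

lemma macmahon_term_Suc_left:
  "(of_nat n + 1 - of_nat j) * macmahon_term (Suc n) j =
     -4 * (of_nat n + 1 + 2 * of_nat j) * macmahon_term n j"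
proof (induction j)
  case (Suc j)
  let ?n = "of_nat n :: rat" and ?j = "of_nat j :: rat"
  define d where "d = -4 * (?j + 1) ^ 3"
  have "(?n + 1 - of_nat (Suc j)) * macmahon_term (Suc n) (Suc j) =
    (?n - ?j) * (((?n + 1 - ?j) * macmahon_term (Suc n) j) *
      ((?n + 2 * ?j + 2) * (?n + 2 * ?j + 3))) / d"
    unfolding d_def by (simp add: algebra_simps)
  also have "\<dots> = (?n - ?j) * ((-4 * (?n + 1 + 2 * ?j) * macmahon_term n j) *
      ((?n + 2 * ?j + 2) * (?n + 2 * ?j + 3))) / d"
    by (simp only: Suc.IH)
  also have "\<dots> = -4 * (?n + 1 + 2 * of_nat (Suc j)) *
      (macmahon_term n j * ((?n + 2 * ?j + 1) * (?n + 2 * ?j + 2) * (?n - ?j)) / d)"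
    by (simp add: algebra_simps)
  also have "\<dots> = -4 * (?n + 1 + 2 * of_nat (Suc j)) * macmahon_term n (Suc j)"
    by (simp add: d_def)
  finally show ?case .
qed (simp add: algebra_simps)

section \<open>Franel's three-term recurrence for both sums\<close>

definition franel_op :: "nat \<Rightarrow> rat \<Rightarrow> rat \<Rightarrow> rat \<Rightarrow> rat" where
  "franel_op n a b c = (of_nat n + 2) ^ 2 * c
     - (7 * of_nat n ^ 2 + 21 * of_nat n + 16) * b - 8 * (of_nat n + 1) ^ 2 * a"

text \<open>Linearity in the three values lets the recurrence be checked summand by summand.\<close>

lemma franel_op_sum:
  "franel_op n (\<Sum>k\<in>A. f k) (\<Sum>k\<in>A. g k) (\<Sum>k\<in>A. h k) = (\<Sum>k\<in>A. franel_op n (f k) (g k) (h k))"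
  by (simp add: franel_op_def sum_distrib_left sum_subtractf)

text \<open>The leading coefficient \<open>(n + 2) ^ 2\<close> never vanishes, so two initial values
  fix the sequence.\<close>

lemma franel_op_determines:
  assumes "\<And>n. franel_op n (f n) (f (Suc n)) (f (Suc (Suc n))) = 0"
    and "\<And>n. franel_op n (g n) (g (Suc n)) (g (Suc (Suc n))) = 0"
    and "f 0 = g 0" and "f 1 = g 1"
  shows "f n = g n"
proof -
  have "f n = g n \<and> f (Suc n) = g (Suc n)"
  proof (induction n)
    case (Suc n)
    have "(of_nat n + 2 :: rat) \<noteq> 0" by (metis of_nat_Suc of_nat_neq_0 of_nat_add of_nat_numeral add_2_eq_Suc')
    moreover have "(of_nat n + 2) ^ 2 * (f (Suc (Suc n)) - g (Suc (Suc n))) = 0"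
      using assms(1,2)[of n] Suc by (simp add: franel_op_def algebra_simps)
    ultimately show ?case using Suc by simp
  qed (use assms in auto)
  then show ?thesis ..
qed

lemma sum_macmahon_term_extend:
  "n < N \<Longrightarrow> (\<Sum>j\<le>n. macmahon_term n j) = (\<Sum>j<N. macmahon_term n j)"
  by (rule sum.mono_neutral_left) (auto simp: macmahon_term_eq_0)

text \<open>Found with Zeilberger's algorithm; likewise \<open>choose_cert\<close> below.\<close>

definition macmahon_cert :: "nat \<Rightarrow> nat \<Rightarrow> rat" where
  "macmahon_cert n j = - 3 * (3 * of_nat n + 5) * of_nat j ^ 3 * macmahon_term (n + 2) j /
     ((of_nat n + 1 + 2 * of_nat j) * (of_nat n + 2 + 2 * of_nat j))"

text \<open>Everything is written as a multiple of \<open>macmahon_term (n + 2) j\<close>. Going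
  down in \<open>n\<close> divides only by \<open>n + 2 + 2 * j\<close> and
  \<open>n + 1 + 2 * j\<close>, which never vanish; going up would divide by
  \<open>n + 1 - j\<close> and \<open>n + 2 - j\<close>.\<close>

lemma macmahon_term_franel_op:
  "franel_op n (macmahon_term n j) (macmahon_term (n + 1) j) (macmahon_term (n + 2) j)
    = macmahon_cert n (Suc j) - macmahon_cert n j"
proof -
  define N J h where "N = (of_nat n :: rat)" "J = (of_nat j :: rat)" "h = macmahon_term (n + 2) j"
  have pos: "N \<ge> 0" "J \<ge> 0" by (simp_all add: N_J_h_def)
  have nz: "N + 1 + 2 * J \<noteq> 0" "N + 2 + 2 * J \<noteq> 0" "N + 3 + 2 * J \<noteq> 0" "N + 4 + 2 * J \<noteq> 0" "J + 1 \<noteq> 0"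
    using pos by linarith+
  have aux: "x / (- 4 * b) * c / (- 4 * d) = x * c / (16 * (b * d))" for x b c d :: rat
    by simp
  have canc: "- 3 * x * c * (h * (a * b * d) / (- 4 * c)) / (a * b) = 3 * x * d * h / 4"
    if "a \<noteq> 0" "b \<noteq> 0" "c \<noteq> 0" for x a b c d :: rat
    using that by simp
  have h1: "macmahon_term (n + 1) j = h * (N + 2 - J) / (-4 * (N + 2 + 2 * J))"
    using macmahon_term_Suc_left[of "n + 1" j] nz by (simp add: N_J_h_def field_simps)
  have "macmahon_term n j = macmahon_term (n + 1) j * (N + 1 - J) / (-4 * (N + 1 + 2 * J))"
    using macmahon_term_Suc_left[of "n" j] nz by (simp add: N_J_h_def field_simps)
  then have h0: "macmahon_term n j = h * ((N + 2 - J) * (N + 1 - J)) / (16 * ((N + 2 + 2 * J) * (N + 1 + 2 * J)))"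
    unfolding h1 aux by (simp only: mult.assoc)
  have "macmahon_term (n + 2) (Suc j) = h * ((N + 3 + 2 * J) * (N + 4 + 2 * J) * (N + 2 - J)) / (-4 * (J + 1) ^ 3)"
    by (simp add: N_J_h_def algebra_simps)
  moreover have "of_nat (Suc j) = J + 1" "N + 1 + 2 * (J + 1) = N + 3 + 2 * J" "N + 2 + 2 * (J + 1) = N + 4 + 2 * J"
    by (simp_all add: N_J_h_def)
  ultimately have "macmahon_cert n (Suc j) = - 3 * (3 * N + 5) * (J + 1) ^ 3 *
      (h * ((N + 3 + 2 * J) * (N + 4 + 2 * J) * (N + 2 - J)) / (-4 * (J + 1) ^ 3))
      / ((N + 3 + 2 * J) * (N + 4 + 2 * J))"
    by (simp only: macmahon_cert_def N_J_h_def(1)[symmetric])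
  also have "\<dots> = 3 * (3 * N + 5) * (N + 2 - J) * h / 4"
    using nz(3-5) by (subst canc) auto
  finally have GS: "macmahon_cert n (Suc j) = \<dots>" .
  have Gj: "macmahon_cert n j = - 3 * (3 * N + 5) * J ^ 3 * h / ((N + 1 + 2 * J) * (N + 2 + 2 * J))"
    by (simp only: macmahon_cert_def N_J_h_def)
  \<comment> \<open>\<open>op\<close> and \<open>dG\<close> extract the common factor
    \<open>h / (16 * b * d)\<close> from the two sides, so that only the polynomial identity
    \<open>poly\<close> remains.\<close>
  have op: "x * h - y * (h * a / (-4 * d)) - 8 * z * (h * (a * e) / (16 * (d * b))) =
      h / (16 * b * d) * (16 * x * b * d + 4 * y * a * b - 8 * z * a * e)"
    if "b \<noteq> 0" "d \<noteq> 0" for x y z a b d e :: rat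
    using that by (simp add: field_simps)
  have dG: "3 * x * a * h / 4 - (- 3 * x * c * h / (b * d)) =
      h / (16 * b * d) * (12 * x * a * b * d + 48 * x * c)"
    if "b \<noteq> 0" "d \<noteq> 0" for x a b c d :: rat
    using that by (simp add: field_simps)
  have poly: "16 * (N + 2) ^ 2 * (N + 1 + 2 * J) * (N + 2 + 2 * J) +
      4 * (7 * N ^ 2 + 21 * N + 16) * (N + 2 - J) * (N + 1 + 2 * J) -
      8 * (N + 1) ^ 2 * (N + 2 - J) * (N + 1 - J) =
      12 * (3 * N + 5) * (N + 2 - J) * (N + 1 + 2 * J) * (N + 2 + 2 * J) + 48 * (3 * N + 5) * J ^ 3"
    by algebra
  show ?thesis
    unfolding franel_op_def GS Gj h0 h1 N_J_h_def(3)[symmetric] N_J_h_def(1)[symmetric]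
      op[OF nz(1,2)] dG[OF nz(1,2)] poly ..
qed

lemma sum_macmahon_term_franel_op:
  defines "F \<equiv> (\<lambda>n. \<Sum>j\<le>n. macmahon_term n j)"
  shows "franel_op n (F n) (F (Suc n)) (F (Suc (Suc n))) = 0"
proof -
  have "F k = (\<Sum>j<n + 3. macmahon_term k j)" if "k < n + 3" for k
    unfolding F_def by (rule sum_macmahon_term_extend[OF that])
  then have "franel_op n (F n) (F (Suc n)) (F (Suc (Suc n))) =
    (\<Sum>j<n + 3. franel_op n (macmahon_term n j) (macmahon_term (n + 1) j) (macmahon_term (n + 2) j))"
    by (simp add: franel_op_sum del: sum.lessThan_Suc)
  also have "\<dots> = 0"
    \<comment> \<open>The certificate vanishes at \<open>0\<close> because of \<open>j ^ 3\<close>,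
      and at \<open>n + 3\<close> because \<open>macmahon_term (n + 2) (n + 3) = 0\<close>.\<close>
    unfolding macmahon_term_franel_op sum_lessThan_telescope
    by (simp add: macmahon_cert_def macmahon_term_eq_0)
  finally show ?thesis .
qed

definition choose_cert :: "nat \<Rightarrow> nat \<Rightarrow> rat" where
  "choose_cert n i = of_nat (Suc n choose i) ^ 3 *
     (4 * of_nat i ^ 3 - 18 * (of_nat n + 1) * of_nat i ^ 2 + (of_nat n + 1) * (27 * of_nat n + 30) * of_nat i
      - (of_nat n + 1) * (14 * of_nat n ^ 2 + 33 * of_nat n + 20)) / (of_nat n + 1)"

text \<open>With the lower index shifted to \<open>Suc i\<close>, all three binomials are multiples
  of \<open>z = (n + 1 choose i)\<close> whose denominators involve only \<open>i + 1\<close> and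
  \<open>n + 1\<close>. Hence no case distinction is needed near \<open>i = n\<close>, and a
  polynomial identity is left.\<close>

lemma cubed_choose_franel_op:
  "franel_op n (of_nat (n choose Suc i) ^ 3) (of_nat (Suc n choose Suc i) ^ 3)
      (of_nat (Suc (Suc n) choose Suc i) ^ 3) = choose_cert n (Suc i) - choose_cert n i"
proof -
  define Q where "Q = (\<lambda>x::rat. 4 * x ^ 3 - 18 * (of_nat n + 1) * x ^ 2 + (of_nat n + 1) * (27 * of_nat n + 30) * x
      - (of_nat n + 1) * (14 * of_nat n ^ 2 + 33 * of_nat n + 20))"
  define N I z where "N = (of_nat n :: rat)" "I = (of_nat i :: rat)" "z = (of_nat (Suc n choose i) :: rat)"
  have nz: "N + 1 \<noteq> 0" "I + 1 \<noteq> 0"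
    unfolding N_I_z_def by (metis of_nat_Suc of_nat_neq_0 add.commute)+
  have "of_nat (Suc i * (Suc n choose Suc i)) = (I + 1) * of_nat (Suc n choose Suc i)"
    by (simp add: N_I_z_def algebra_simps)
  moreover have "of_nat (Suc i * (Suc n choose Suc i)) = (N + 1 - I) * z"
  proof (cases "i \<le> Suc n")
    case True
    have "Suc i * (Suc n choose Suc i) = (Suc n - i) * (Suc n choose i)"
      using Suc_times_binomial_add[of i "n - i"] binomial_absorption[of i "Suc n"]
        binomial_absorb_comp[of "Suc n" i] by simp
    then show ?thesis using True unfolding N_I_z_def by (simp only: of_nat_mult of_nat_diff) simp
  qed (simp add: N_I_z_def binomial_eq_0)
  ultimately have w: "of_nat (Suc n choose Suc i) = z * (N + 1 - I) / (I + 1)"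
    using nz by (simp add: field_simps)
  have y: "of_nat (n choose Suc i) = of_nat (Suc n choose Suc i) * (N - I) / (N + 1)"
  proof (cases "i \<le> n")
    case True
    have "(Suc n - Suc i) * (Suc n choose Suc i) = Suc n * (n choose Suc i)"
      using binomial_absorb_comp[of "Suc n" "Suc i"] by simp
    then have "of_nat ((n - i) * (Suc n choose Suc i)) = (of_nat (Suc n * (n choose Suc i)) :: rat)"
      by simp
    then show ?thesis using True nz unfolding N_I_z_def
      by (simp add: of_nat_diff field_simps del: binomial_Suc_Suc)
  qed (simp add: binomial_eq_0)
  have v: "of_nat (Suc (Suc n) choose Suc i) = z * (N + 2) / (I + 1)"
    using w nz unfolding binomial_Suc_Suc[of "Suc n"] of_nat_add N_I_z_def(3)[symmetric]
    by (simp add: field_simps)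
  have GS: "choose_cert n (Suc i) = (z * (N + 1 - I) / (I + 1)) ^ 3 * Q (I + 1) / (N + 1)"
    by (simp only: choose_cert_def Q_def w of_nat_Suc N_I_z_def(1,2) add.commute)
  have Gi: "choose_cert n i = z ^ 3 * Q I / (N + 1)"
    by (simp only: choose_cert_def Q_def N_I_z_def)
  have y': "of_nat (n choose Suc i) = z * ((N + 1 - I) * (N - I)) / ((I + 1) * (N + 1))"
    unfolding y unfolding w by (simp only: times_divide_eq_left divide_divide_eq_left mult.assoc)
  have op: "x ^ 2 * (z * x / b) ^ 3 - y * (z * a / b) ^ 3 - 8 * d ^ 2 * (z * (a * e) / (b * d)) ^ 3 =
      z ^ 3 / (b ^ 3 * d) * (d * (x ^ 5 - y * a ^ 3) - 8 * a ^ 3 * e ^ 3)"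
    if "b \<noteq> 0" "d \<noteq> 0" for x y a b d e :: rat
  proof -
    have "x ^ 2 * (z * x / b) ^ 3 = z ^ 3 / (b ^ 3 * d) * (d * x ^ 5)"
      using that by (simp add: power_mult_distrib power_divide flip: power_add)
    moreover have "y * (z * a / b) ^ 3 = z ^ 3 / (b ^ 3 * d) * (d * (y * a ^ 3))"
      using that by (simp add: power_mult_distrib power_divide)
    moreover have "8 * d ^ 2 * (z * (a * e) / (b * d)) ^ 3 = z ^ 3 / (b ^ 3 * d) * (8 * a ^ 3 * e ^ 3)"
      using that by (simp add: power_mult_distrib power_divide power2_eq_square power3_eq_cube mult_ac)
    ultimately show ?thesis by (simp only: right_diff_distrib)
  qed
  have dG: "(z * a / b) ^ 3 * x / d - z ^ 3 * y / d = z ^ 3 / (b ^ 3 * d) * (a ^ 3 * x - b ^ 3 * y)"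
    if "b \<noteq> 0" "d \<noteq> 0" for x y a b d :: rat
    using that by (simp add: field_simps)
  have poly: "(N + 1) * ((N + 2) ^ 5 - (7 * N ^ 2 + 21 * N + 16) * (N + 1 - I) ^ 3)
      - 8 * (N + 1 - I) ^ 3 * (N - I) ^ 3 = (N + 1 - I) ^ 3 * Q (I + 1) - (I + 1) ^ 3 * Q I"
    unfolding Q_def N_I_z_def(1)[symmetric] by algebra
  show ?thesis
    unfolding franel_op_def GS Gi v y' unfolding w N_I_z_def(1)[symmetric]
      op[OF nz(2,1)] dG[OF nz(2,1)] poly ..
qed

lemma franel_extend: "n \<le> N \<Longrightarrow> (of_nat (franel n) :: rat) = (\<Sum>k\<le>N. of_nat (n choose k) ^ 3)"
  unfolding franel_def of_nat_sum of_nat_power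
  by (rule sum.mono_neutral_left) auto

lemma franel_franel_op:
  "franel_op n (of_nat (franel n)) (of_nat (franel (Suc n))) (of_nat (franel (Suc (Suc n)))) = 0"
proof -
  have nz: "(of_nat n + 1 :: rat) \<noteq> 0" by (metis of_nat_Suc of_nat_neq_0 add.commute)
  let ?L = "\<lambda>k. franel_op n (of_nat (n choose k) ^ 3) (of_nat (Suc n choose k) ^ 3)
      (of_nat (Suc (Suc n) choose k) ^ 3)"
  have "franel_op n (of_nat (franel n)) (of_nat (franel (Suc n))) (of_nat (franel (Suc (Suc n)))) =
    (\<Sum>k\<le>Suc (Suc n). ?L k)"
    by (simp add: franel_extend[of _ "Suc (Suc n)"] franel_op_sum
        del: sum.atMost_Suc binomial_Suc_Suc)
  also have "\<dots> = ?L 0 + (\<Sum>i<Suc (Suc n). ?L (Suc i))"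
    by (simp only: lessThan_Suc_atMost[symmetric] sum.lessThan_Suc_shift)
  also have "\<dots> = 0"
    \<comment> \<open>The upper end vanishes with \<open>(n + 1 choose n + 2)\<close>. The term
      \<open>?L 0\<close> and \<open>choose_cert n 0\<close> are both
      \<open>-(14 n^2 + 33 n + 20)\<close> and cancel.\<close>
    unfolding cubed_choose_franel_op sum_lessThan_telescope
    by (simp add: franel_op_def choose_cert_def binomial_eq_0 nz) (simp add: power2_eq_square algebra_simps)
  finally show ?thesis .
qed

lemma franel_eq_sum_macmahon_term: "of_nat (franel n) = (\<Sum>j\<le>n. macmahon_term n j)"
  by (rule franel_op_determines[OF franel_franel_op sum_macmahon_term_franel_op])
    (simp_all add: franel_def)

section \<open>Gosper summation over \<open>k\<close>, leaving a single sum over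
  \<open>j\<close>\<close>

lemma macmahon_term_gosper:
  "(2 * of_nat j + 1) * (\<Sum>k<n. (3 * of_nat k + 1) / (-16) ^ k * of_nat (2 * k choose k) * macmahon_term k j) =
    2 * of_nat n * (of_nat n - of_nat j) / (-16) ^ n * of_nat (2 * n choose n) * macmahon_term n j"
proof (induction n)
  case (Suc k)
  define K J c h where "K = (of_nat k :: rat)" "J = (of_nat j :: rat)" "c = (of_nat (2 * k choose k) :: rat)"
    "h = macmahon_term k j"
  have "Suc k * (2 * Suc k choose Suc k) = 2 * (2 * k + 1) * (2 * k choose k)"
    using Suc_times_binomial[of k "2 * k + 1"] Suc_times_binomial[of k "2 * k"]
      binomial_symmetric[of k "2*k+1"] by (simp add: algebra_simps)
  then have "of_nat (Suc k * (2 * Suc k choose Suc k)) = (of_nat (2 * (2 * k + 1) * (2 * k choose k)) :: rat)"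
    by (simp only:)
  then have c: "(K + 1) * of_nat (2 * Suc k choose Suc k) = 2 * (2 * K + 1) * c"
    by (simp add: K_J_c_h_def algebra_simps del: binomial_Suc_Suc)
  have h: "(K + 1 - J) * macmahon_term (Suc k) j = -4 * (K + 1 + 2 * J) * h"
    using macmahon_term_Suc_left[of k j] by (simp add: K_J_c_h_def)
  \<comment> \<open>The factor \<open>K + 1 - J\<close> of the antidifference is the one that the
    ratio in \<open>n\<close> carries, so nothing is divided by zero at
    \<open>j = k + 1\<close>.\<close>
  have "2 * of_nat (Suc k) * (of_nat (Suc k) - of_nat j) / (-16) ^ Suc k *
      of_nat (2 * Suc k choose Suc k) * macmahon_term (Suc k) j =
      2 * ((K + 1) * of_nat (2 * Suc k choose Suc k)) * ((K + 1 - J) * macmahon_term (Suc k) j) / (-16) ^ Suc k"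
    by (simp add: K_J_c_h_def algebra_simps del: binomial_Suc_Suc macmahon_term.simps)
  also have "\<dots> = (2 * K + 1) * (K + 1 + 2 * J) * c * h / (-16) ^ k"
    unfolding c h by (simp add: field_simps)
  \<comment> \<open>Uses \<open>(2K+1)(K+1+2J) = (2J+1)(3K+1) + 2K(K-J)\<close>, which is where the
    weight \<open>3k+1\<close> enters.\<close>
  also have "\<dots> = (2 * J + 1) * ((3 * K + 1) / (-16) ^ k * c * h) + 2 * K * (K - J) / (-16) ^ k * c * h"
    by (simp add: field_simps)
  finally show ?case
    unfolding sum.lessThan_Suc distrib_left Suc.IH K_J_c_h_def by (simp only: add.commute)
qed simp

text \<open>For \<open>j < n\<close> this is \<open>(n+2j)! / ((n-1-j)! j!^3 (-4)^j)\<close>: the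
  factor \<open>n - j\<close> shortens the factorial, and dividing by \<open>(-4) ^ n\<close> leaves
  a power depending on \<open>j\<close> alone.\<close>

definition scaled_term :: "nat \<Rightarrow> nat \<Rightarrow> rat" where
  "scaled_term n j = (of_nat n - of_nat j) * macmahon_term n j / (-4) ^ n"

lemma scaled_term_0: "scaled_term n 0 = of_nat n"
  by (simp add: scaled_term_def)

lemma scaled_term_Suc:
  "scaled_term n (Suc j) = scaled_term n j * ((of_nat n - of_nat j - 1) * (of_nat n + 2 * of_nat j + 1) *
     (of_nat n + 2 * of_nat j + 2)) / (-4 * (of_nat j + 1) ^ 3)"
proof -
  have "(x - (1 + y)) * (h * (a * b * (x - y)) / d) / e = (x - y) * h / e * ((x - y - 1) * a * b) / d"
    for x y h a b d e :: rat
    by (simp add: field_simps)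
  then show ?thesis
    unfolding scaled_term_def macmahon_term.simps of_nat_Suc .
qed

lemma scaled_term_fact:
  "j < n \<Longrightarrow> scaled_term n j * (fact (n - 1 - j) * fact j ^ 3 * (-4) ^ j) = fact (n + 2 * j)"
proof (induction j)
  case 0
  then show ?case using fact_reduce[of n, where 'a=rat] by (simp add: scaled_term_0)
next
  case (Suc j)
  define e where "e = (of_nat n + 2 * of_nat j + 1) * (of_nat n + 2 * of_nat j + 2 :: rat)"
  have j: "of_nat j + 1 \<noteq> (0 :: rat)" by (metis of_nat_Suc of_nat_neq_0 add.commute)
  have "n - 1 - j = Suc (n - 1 - Suc j)" using Suc.prems by simp
  then have f: "fact (n - 1 - j) = (of_nat n - of_nat j - 1) * (fact (n - 1 - Suc j) :: rat)"
    using Suc.prems by (simp add: of_nat_diff)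
  have "s * (a * e) / (-4 * i ^ 3) * (x * (i * y) ^ 3 * (-4 * z)) = s * (a * x * y ^ 3 * z) * e"
    if "i \<noteq> 0" for a i s x y z :: rat
    using that by (simp add: power_mult_distrib)
  from this[OF j] have "scaled_term n (Suc j) * (fact (n - 1 - Suc j) * fact (Suc j) ^ 3 * (-4) ^ Suc j) =
      scaled_term n j * (fact (n - 1 - j) * fact j ^ 3 * (-4) ^ j) * e"
    unfolding scaled_term_Suc f e_def fact_Suc of_nat_Suc power_Suc by (simp only: mult.assoc add.commute)
  also have "\<dots> = fact (n + 2 * j) * e"
    using Suc by simp
  also have "\<dots> = fact (n + 2 * Suc j)"
    by (simp add: e_def algebra_simps)
  finally show ?case .
qed

text \<open>Since \<open>macmahon_term k j\<close> vanishes for \<open>j > k\<close>, the inner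
  range can be made \<open>j < n\<close> for every \<open>k\<close>; then the sums are swapped and
  the Gosper formula applies for each \<open>j\<close>.\<close>

lemma franel_sum_eq_scaled_term_sum:
  "(\<Sum>k<n. (3 * of_nat k + 1) / (-16) ^ k * of_nat (2 * k choose k) * of_nat (franel k)) =
     (\<Sum>j<n. 2 * of_nat n * of_nat (2 * n choose n) / 4 ^ n * scaled_term n j / (2 * of_nat j + 1))"
proof -
  let ?w = "\<lambda>k. (3 * of_nat k + 1) / (-16) ^ k * of_nat (2 * k choose k) :: rat"
  have "(\<Sum>k<n. ?w k * of_nat (franel k)) = (\<Sum>k<n. \<Sum>j<n. ?w k * macmahon_term k j)"
    by (intro sum.cong refl)
      (simp add: franel_eq_sum_macmahon_term sum_macmahon_term_extend[of _ n] sum_distrib_left)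
  also have "\<dots> = (\<Sum>j<n. \<Sum>k<n. ?w k * macmahon_term k j)"
    by (rule sum.swap)
  also have "\<dots> = (\<Sum>j<n. 2 * of_nat n * of_nat (2 * n choose n) / 4 ^ n * scaled_term n j / (2 * of_nat j + 1))"
  proof (intro sum.cong refl)
    fix j
    have "2 * of_nat j + 1 \<noteq> (0 :: rat)" using of_nat_0_le_iff[of j, where 'a=rat] by linarith
    then have "(\<Sum>k<n. ?w k * macmahon_term k j) = 2 * of_nat n * (of_nat n - of_nat j) / (-16) ^ n *
        of_nat (2 * n choose n) * macmahon_term n j / (2 * of_nat j + 1)"
      by (rule eq_divide_imp) (subst mult.commute, rule macmahon_term_gosper)
    also have "(-16 :: rat) ^ n = 4 ^ n * (-4) ^ n" by (simp flip: power_mult_distrib)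
    finally show "(\<Sum>k<n. ?w k * macmahon_term k j) =
        2 * of_nat n * of_nat (2 * n choose n) / 4 ^ n * scaled_term n j / (2 * of_nat j + 1)"
      by (simp add: scaled_term_def mult_ac)
  qed
  finally show ?thesis .
qed

section \<open>Congruences between rational numbers\<close>

text \<open>For prime \<open>p\<close>, membership in the localisation of the integers at
  \<open>p\<close>, phrased as in \<open>rat_cong\<close>.\<close>

definition p_integral :: "nat \<Rightarrow> rat \<Rightarrow> bool" where
  "p_integral p x \<longleftrightarrow> coprime (snd (quotient_of x)) (int p)"

lemma rat_cong_iff: "rat_cong a b p r \<longleftrightarrow> (\<exists>x. a - b = of_nat p ^ r * x \<and> p_integral p x)"
  by (simp add: rat_cong_def p_integral_def)

context
  fixes p :: nat
  assumes p: "prime p"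
begin

text \<open>Replaces lowest terms by any fraction with denominator prime to \<open>p\<close>: the
  reduced denominator divides every other one. The ring operations then need only fraction
  arithmetic.\<close>

lemma p_integral_iff: "p_integral p x \<longleftrightarrow> (\<exists>a b. \<not> int p dvd b \<and> x = of_int a / of_int b)"
proof
  assume "p_integral p x"
  then have "int p dvd snd (quotient_of x) \<Longrightarrow> is_unit (int p)"
    unfolding p_integral_def by (rule coprime_common_divisor) simp_all
  then have "\<not> int p dvd snd (quotient_of x)"
    using p prime_gt_1_nat[of p] by auto
  moreover have "x = of_int (fst (quotient_of x)) / of_int (snd (quotient_of x))"
    by (simp add: quotient_of_div)
  ultimately show "\<exists>a b. \<not> int p dvd b \<and> x = of_int a / of_int b"
    by blast
next
  assume "\<exists>a b. \<not> int p dvd b \<and> x = of_int a / of_int b"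
  then obtain a b where b: "\<not> int p dvd b" and x: "x = of_int a / of_int b"
    by blast
  obtain c d where cd: "quotient_of x = (c, d)"
    by fastforce
  have d: "d > 0" "coprime c d" "x = of_int c / of_int d"
    using cd quotient_of_denom_pos quotient_of_coprime quotient_of_div by blast+
  have "b \<noteq> 0" using b by auto
  then have "of_int (a * d) = (of_int (c * b) :: rat)"
    using x d by (simp add: field_simps)
  then have "d dvd c * b"
    by (metis of_int_eq_iff dvd_triv_right)
  then have "d dvd b"
    using d(2) by (simp add: coprime_commute coprime_dvd_mult_right_iff)
  then have "\<not> int p dvd d"
    using b dvd_trans by blast
  then have "coprime (int p) d"
    using p by (intro prime_imp_coprime) auto
  then show "p_integral p x"
    by (simp add: p_integral_def cd coprime_commute)
qed

lemma p_integral_of_int: "p_integral p (of_int a)"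
  unfolding p_integral_iff using p by (intro exI[of _ a] exI[of _ 1]) auto

lemma p_integral_of_nat: "p_integral p (of_nat a)"
  using p_integral_of_int[of "int a"] by simp

lemma p_integral_numeral: "p_integral p (numeral a)"
  using p_integral_of_nat[of "numeral a"] by simp

lemma p_integral_1: "p_integral p 1"
  using p_integral_of_nat[of 1] by simp

lemma p_integral_0: "p_integral p 0"
  using p_integral_of_nat[of 0] by simp

lemma p_integral_mult:
  assumes "p_integral p x" and "p_integral p y"
  shows "p_integral p (x * y)"
proof -
  obtain a b c d where "\<not> int p dvd b" "x = of_int a / of_int b" "\<not> int p dvd d" "y = of_int c / of_int d"
    using assms unfolding p_integral_iff by blast
  moreover from this have "\<not> int p dvd b * d"
    using p by (simp add: prime_dvd_mult_iff)
  moreover from calculation have "x * y = of_int (a * c) / of_int (b * d)"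
    by simp
  ultimately show ?thesis unfolding p_integral_iff by blast
qed

lemma p_integral_add:
  assumes "p_integral p x" and "p_integral p y"
  shows "p_integral p (x + y)"
proof -
  obtain a b c d where *: "\<not> int p dvd b" "x = of_int a / of_int b" "\<not> int p dvd d" "y = of_int c / of_int d"
    using assms unfolding p_integral_iff by blast
  moreover from this have "\<not> int p dvd b * d"
    using p by (simp add: prime_dvd_mult_iff)
  moreover have "b \<noteq> 0" "d \<noteq> 0" using * by auto
  with * have "x + y = of_int (a * d + c * b) / of_int (b * d)"
    by (simp add: field_simps)
  ultimately show ?thesis unfolding p_integral_iff by blast
qed

lemma p_integral_uminus: "p_integral p x \<Longrightarrow> p_integral p (- x)"
  using p_integral_mult[OF p_integral_of_int[of "-1"]] by simp

lemma p_integral_diff: "p_integral p x \<Longrightarrow> p_integral p y \<Longrightarrow> p_integral p (x - y)"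
  using p_integral_add[OF _ p_integral_uminus] by fastforce

lemma p_integral_power: "p_integral p x \<Longrightarrow> p_integral p (x ^ n)"
  by (induction n) (simp_all add: p_integral_1 p_integral_mult)

lemma p_integral_prod: "(\<And>i. i \<in> A \<Longrightarrow> p_integral p (f i)) \<Longrightarrow> p_integral p (prod f A)"
  by (induction A rule: infinite_finite_induct) (simp_all add: p_integral_1 p_integral_mult)

lemma p_integral_divide_of_nat:
  assumes "p_integral p x" and "\<not> p dvd n"
  shows "p_integral p (x / of_nat n)"
proof -
  have "p_integral p (1 / of_nat n)"
    unfolding p_integral_iff using assms(2) by (intro exI[of _ 1] exI[of _ "int n"]) auto
  from p_integral_mult[OF assms(1) this] show ?thesis by simp
qed

lemmas p_integral_intros = p_integral_of_int p_integral_of_nat p_integral_0 p_integral_1 p_integral_numeral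
  p_integral_mult p_integral_add p_integral_uminus p_integral_diff p_integral_power
  p_integral_prod

lemma rat_congI: "a - b = of_nat p ^ r * x \<Longrightarrow> p_integral p x \<Longrightarrow> rat_cong a b p r"
  unfolding rat_cong_iff by blast

lemma rat_cong_refl: "rat_cong a a p r"
  by (rule rat_congI[of _ _ _ 0]) (simp_all add: p_integral_0)

lemma rat_cong_trans:
  assumes "rat_cong a b p r" and "rat_cong b c p r"
  shows "rat_cong a c p r"
proof -
  obtain x y where "a - b = of_nat p ^ r * x" "p_integral p x" "b - c = of_nat p ^ r * y" "p_integral p y"
    using assms unfolding rat_cong_iff by blast
  then show ?thesis
    by (intro rat_congI[of _ _ _ "x + y"]) (auto simp: p_integral_add algebra_simps)
qed

lemma rat_cong_add:
  assumes "rat_cong a b p r" and "rat_cong c d p r"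
  shows "rat_cong (a + c) (b + d) p r"
proof -
  obtain x y where "a - b = of_nat p ^ r * x" "p_integral p x" "c - d = of_nat p ^ r * y" "p_integral p y"
    using assms unfolding rat_cong_iff by blast
  then show ?thesis
    by (intro rat_congI[of _ _ _ "x + y"]) (auto simp: p_integral_add algebra_simps)
qed

lemma rat_cong_sum:
  "(\<And>i. i \<in> A \<Longrightarrow> rat_cong (f i) (g i) p r) \<Longrightarrow> rat_cong (sum f A) (sum g A) p r"
  by (induction A rule: infinite_finite_induct) (simp_all add: rat_cong_refl rat_cong_add)

lemma rat_cong_mult:
  assumes "rat_cong a b p r" and "rat_cong c d p r" and "p_integral p a" and "p_integral p d"
  shows "rat_cong (a * c) (b * d) p r"
proof -
  obtain x y where xy: "a - b = of_nat p ^ r * x" "p_integral p x" "c - d = of_nat p ^ r * y" "p_integral p y"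
    using assms unfolding rat_cong_iff by blast
  have "a * c - b * d = a * (c - d) + (a - b) * d"
    by (simp add: algebra_simps)
  also have "\<dots> = of_nat p ^ r * (a * y + x * d)"
    unfolding xy by (simp add: algebra_simps)
  finally show ?thesis
    by (rule rat_congI) (intro p_integral_intros xy assms)
qed

lemma rat_cong_mult_left: "rat_cong a b p r \<Longrightarrow> p_integral p c \<Longrightarrow> rat_cong (c * a) (c * b) p r"
  unfolding rat_cong_iff by (metis mult.left_commute p_integral_mult right_diff_distrib)

lemma rat_cong_prod:
  assumes "\<And>i. i \<in> A \<Longrightarrow> rat_cong (f i) (g i) p r"
    and "\<And>i. i \<in> A \<Longrightarrow> p_integral p (f i)" and "\<And>i. i \<in> A \<Longrightarrow> p_integral p (g i)"
  shows "rat_cong (prod f A) (prod g A) p r"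
  using assms
  by (induction A rule: infinite_finite_induct) (simp_all add: rat_cong_refl rat_cong_mult p_integral_prod)

text \<open>Raises the modulus: explicit powers of \<open>p\<close> turn congruences modulo
  \<open>p\<close> or \<open>p^2\<close> into ones modulo \<open>p^3\<close>.\<close>

lemma rat_cong_p_power_mult: "rat_cong a b p r \<Longrightarrow> rat_cong (of_nat p ^ s * a) (of_nat p ^ s * b) p (s + r)"
  unfolding rat_cong_iff by (metis mult.assoc power_add right_diff_distrib)

lemma p_integral_of_rat_cong:
  assumes "rat_cong a b p r" and "p_integral p b"
  shows "p_integral p a"
proof -
  obtain x where x: "a - b = of_nat p ^ r * x" "p_integral p x"
    using assms unfolding rat_cong_iff by blast
  have "p_integral p (b + of_nat p ^ r * x)"
    using x(2) assms(2) by (intro p_integral_intros)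
  then show ?thesis
    by (simp flip: x(1))
qed

end

section \<open>Binomial sums and products\<close>

text \<open>The factors are \<open>-(n+1-i)/i\<close>. For \<open>n = p - 1\<close> the product
  exhibits the binomial as a perturbation of 1 in powers of \<open>p\<close>.\<close>

lemma prod_one_minus_divide_eq_choose:
  "(\<Prod>i=1..k. 1 - (of_nat n + 1) / of_nat i) = (-1) ^ k * (of_nat (n choose k) :: rat)"
proof (induction k)
  case (Suc k)
  have "Suc k * (n choose Suc k) = (n - k) * (n choose k)"
    by (metis binomial_absorb_comp binomial_absorption)
  then have "of_nat (Suc k * (n choose Suc k)) = (of_nat ((n - k) * (n choose k)) :: rat)"
    by (simp only:)
  also have "\<dots> = (of_nat n - of_nat k) * of_nat (n choose k)"
    by (cases "k \<le> n") (simp_all add: of_nat_diff binomial_eq_0)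
  finally have "of_nat (n choose Suc k) = (of_nat n - of_nat k) * (of_nat (n choose k) :: rat) / of_nat (Suc k)"
    by (simp only: of_nat_mult nonzero_eq_divide_eq[OF of_nat_neq_0] mult.commute)
  moreover have "1 - (of_nat n + 1) / of_nat (Suc k) = - ((of_nat n - of_nat k) / (of_nat (Suc k) :: rat))"
    by (simp add: field_simps)
  ultimately show ?case
    using Suc by simp
qed simp

lemma prod_one_minus_divide_double_eq_choose:
  "(\<Prod>i=1..m. 1 - (2 * of_nat m + 1) / (2 * of_nat i)) = (-1) ^ m * (of_nat (2 * m choose m) :: rat) / 4 ^ m"
proof -
  have "(\<Prod>i=1..m. 1 - (2 * of_nat m + 1) / (2 * of_nat i)) =
      (\<Prod>i=1..m. (2 * of_nat i - (2 * of_nat m + 1)) / (2 * of_nat i) :: rat)"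
    by (intro prod.cong) (auto simp: field_simps)
  also have "\<dots> = (\<Prod>i=1..m. 2 * of_nat i - (2 * of_nat m + 1)) / (\<Prod>i=1..m. 2 * of_nat i)"
    by (simp add: prod_dividef)
  \<comment> \<open>Read backwards, the numerators are \<open>-1, -3, ..., -(2m-1)\<close>, that is,
    \<open>-2\<close> times the factors of the Pochhammer symbol at \<open>1/2\<close>.\<close>
  also have "(\<Prod>i=1..m. 2 * of_nat i - (2 * of_nat m + 1)) = (\<Prod>i=1..m. - 2 * (1 / 2 + of_nat (i - 1)) :: rat)"
    by (subst prod.atLeastAtMost_rev) (auto intro!: prod.cong simp: of_nat_diff algebra_simps)
  also have "\<dots> = (- 2) ^ m * pochhammer (1 / 2) m"
    unfolding prod.distrib by (simp add: pochhammer_prod atLeast0LessThan prod.atLeast1_atMost_eq)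
  also have "(\<Prod>i=1..m. 2 * of_nat i) = (2 ^ m * fact m :: rat)"
    unfolding prod.distrib by (simp add: fact_prod)
  also have "(- 2) ^ m * pochhammer (1 / 2) m / (2 ^ m * fact m) =
      ((-1) ^ m * (fact (2 * m) / (fact m * fact m)) / 4 ^ m :: rat)"
    by (simp add: fact_double power_minus[of 2] power_mult)
  also have "fact (2 * m) / (fact m * fact m) = (of_nat (2 * m choose m) :: rat)"
    using binomial_fact[of m "2 * m", where 'a=rat] by simp
  finally show ?thesis
    .
qed

text \<open>Partial fractions of \<open>m! / (x(x+1)...(x+m))\<close>. By Pascal's rule the sum for
  \<open>m + 1\<close> at \<open>x\<close> is the difference of the sums for \<open>m\<close> at
  \<open>x\<close> and \<open>x + 1\<close>, so the induction varies \<open>x\<close>.\<close>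

lemma alternating_binomial_sum_pochhammer:
  fixes x :: rat
  assumes "x > 0"
  shows "(\<Sum>j\<le>m. (-1) ^ j * of_nat (m choose j) / (x + of_nat j)) = fact m / pochhammer x (Suc m)"
  using assms
proof (induction m arbitrary: x)
  case (Suc m)
  have "(\<Sum>j\<le>Suc m. (-1) ^ j * of_nat (Suc m choose j) / (x + of_nat j)) =
      (\<Sum>j\<le>m. (-1) ^ j * of_nat (m choose j) / (x + of_nat j))
      - (\<Sum>j\<le>m. (-1) ^ j * of_nat (m choose j) / (x + 1 + of_nat j))"
  proof -
    have "(\<Sum>j\<le>Suc m. (-1) ^ j * of_nat (Suc m choose j) / (x + of_nat j)) =
        1 / x + (\<Sum>j\<le>m. (-1) ^ Suc j * of_nat (m choose Suc j) / (x + of_nat (Suc j)))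
        - (\<Sum>j\<le>m. (-1) ^ j * of_nat (m choose j) / (x + 1 + of_nat j))"
      unfolding sum.atMost_Suc_shift
      by (simp add: sum.distrib[symmetric] sum_subtractf[symmetric] field_simps add_divide_distrib diff_divide_distrib)
    also have "1 / x + (\<Sum>j\<le>m. (-1) ^ Suc j * of_nat (m choose Suc j) / (x + of_nat (Suc j))) =
        (\<Sum>j\<le>Suc m. (-1) ^ j * of_nat (m choose j) / (x + of_nat j))"
      unfolding sum.atMost_Suc_shift by simp
    finally show ?thesis by (simp add: binomial_eq_0)
  qed
  also have "\<dots> = fact m / pochhammer x (Suc m) - fact m / pochhammer (x + 1) (Suc m)"
    using Suc.IH[of x] Suc.IH[of "x + 1"] Suc.prems by simp
  also have "pochhammer x (Suc m) = pochhammer x (Suc (Suc m)) / (x + of_nat (Suc m))"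
    using Suc.prems by (simp add: pochhammer_Suc[of x "Suc m"] field_simps)
  also have "pochhammer (x + 1) (Suc m) = pochhammer x (Suc (Suc m)) / x"
    using Suc.prems by (simp add: pochhammer_rec[of x "Suc m"])
  finally show ?case
    by (simp add: diff_divide_distrib[symmetric] algebra_simps)
qed simp

text \<open>The case \<open>x = 1/2\<close> of the partial fractions.\<close>

lemma alternating_binomial_sum_odd:
  "(\<Sum>j\<le>m. (-1) ^ j * of_nat (m choose j) / (2 * of_nat j + 1)) =
     (4 ^ m / ((2 * of_nat m + 1) * of_nat (2 * m choose m)) :: rat)"
proof -
  have "(\<Sum>j\<le>m. (-1) ^ j * of_nat (m choose j) / (2 * of_nat j + 1)) =
      (\<Sum>j\<le>m. (-1) ^ j * of_nat (m choose j) / (1 / 2 + of_nat j) / 2 :: rat)"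
    by (intro sum.cong refl) (simp add: field_simps)
  also have "\<dots> = fact m / (pochhammer (1 / 2) m * (1 / 2 + of_nat m)) / 2"
    unfolding sum_divide_distrib[symmetric]
    by (subst alternating_binomial_sum_pochhammer) (simp_all add: pochhammer_Suc)
  also have "\<dots> = 4 ^ m * fact m * fact m / (fact (2 * m) * (2 * of_nat m + 1))"
  proof -
    have "1 / 2 + of_nat m = (2 * of_nat m + 1 :: rat) / 2" by simp
    then show ?thesis
      by (simp only: fact_double power_mult) simp
  qed
  also have "\<dots> = 4 ^ m / ((2 * of_nat m + 1) * of_nat (2 * m choose m))"
    using binomial_fact[of m "2 * m", where 'a=rat] by (simp add: mult_ac)
  finally show ?thesis .
qed

section \<open>The sum modulo the cube of the prime\<close>

locale odd_prime =
  fixes p m :: nat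
  assumes p: "prime p" and p_eq: "p = 2 * m + 1"
begin

lemma not_dvd: "0 < n \<Longrightarrow> n < p \<Longrightarrow> \<not> p dvd n"
  by (auto dest: dvd_imp_le)

lemma m_pos: "0 < m"
  using p p_eq by (cases m) auto

lemma not_dvd_2: "\<not> p dvd 2"
  using m_pos by (intro not_dvd) (auto simp: p_eq)

lemma not_dvd_mult: "\<not> p dvd a \<Longrightarrow> \<not> p dvd b \<Longrightarrow> \<not> p dvd a * b"
  using p by (simp add: prime_dvd_mult_iff)

lemma not_dvd_power: "\<not> p dvd a \<Longrightarrow> \<not> p dvd a ^ n"
  using p prime_dvd_power by blast

lemma not_dvd_fact: "n < p \<Longrightarrow> \<not> p dvd fact n"
  using p by (simp add: prime_dvd_fact_iff)

lemmas integral_intros = p_integral_intros[OF p]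
lemmas integral_divide = p_integral_divide_of_nat[OF p]
lemmas congI = rat_congI[OF p]
lemmas cong_trans = rat_cong_trans[OF p]
lemmas cong_mult = rat_cong_mult[OF p]

section \<open>The constants \<open>u\<close>, \<open>b\<close>, \<open>c\<close>, \<open>s\<close>
  modulo \<open>p\<close> and \<open>p^2\<close>\<close>

definition u :: rat where "u = 4 ^ m"
definition b :: rat where "b = of_nat (2 * p choose p) / 2"
definition c :: rat where "c = (-1) ^ m * of_nat (2 * m choose m)"
definition s :: rat where "s = c / u"

lemma c_eq_prod: "c = (\<Prod>i=1..m. 1 - of_nat p / of_nat i)"
  using prod_one_minus_divide_eq_choose[of "2 * m" m] by (simp add: c_def p_eq add.commute)

lemma s_eq_prod: "s = (\<Prod>i=1..m. 1 - of_nat p / (2 * of_nat i))"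
  using prod_one_minus_divide_double_eq_choose[of m] by (simp add: s_def c_def u_def p_eq add.commute)

lemma factor_integral: "i \<in> {1..m} \<Longrightarrow> p_integral p (1 - of_nat p / of_nat i)"
  by (intro integral_intros integral_divide not_dvd) (auto simp: p_eq)

lemma factor_double_integral:
  assumes "i \<in> {1..m}"
  shows "p_integral p (1 - of_nat p / (2 * of_nat i))"
proof -
  have "p_integral p (1 - of_nat p / of_nat (2 * i))"
    using assms by (intro integral_intros integral_divide not_dvd) (auto simp: p_eq)
  then show ?thesis by simp
qed

lemma c_cong_1: "rat_cong c 1 p 1"
proof -
  have "rat_cong (\<Prod>i=1..m. 1 - of_nat p / of_nat i) (\<Prod>i=1..m. 1) p 1"
  proof (rule rat_cong_prod[OF p])
    fix i assume i: "i \<in> {1..m}"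
    then have "p_integral p (- 1 / of_nat i)"
      using integral_intros(1)[of "-1"] by (intro integral_divide not_dvd) (auto simp: p_eq)
    then show "rat_cong (1 - of_nat p / of_nat i) 1 p 1"
      by (rule congI[rotated]) simp
  qed (auto intro!: factor_integral integral_intros)
  then show ?thesis by (simp add: c_eq_prod)
qed

lemma s_cong_1: "rat_cong s 1 p 1"
proof -
  have "rat_cong (\<Prod>i=1..m. 1 - of_nat p / (2 * of_nat i)) (\<Prod>i=1..m. 1) p 1"
  proof (rule rat_cong_prod[OF p])
    fix i assume i: "i \<in> {1..m}"
    then have "p_integral p (- 1 / of_nat (2 * i))"
      using integral_intros(1)[of "-1"] by (intro integral_divide not_dvd) (auto simp: p_eq)
    then show "rat_cong (1 - of_nat p / (2 * of_nat i)) 1 p 1"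
      by (rule congI[rotated]) simp
  qed (auto intro!: factor_double_integral integral_intros)
  then show ?thesis by (simp add: s_eq_prod)
qed

text \<open>A weak form of Morley's congruence: it holds because \<open>(1 - p/(2i))\<^sup>2\<close> and \<open>1 - p/i\<close> agree
  modulo \<open>p\<^sup>2\<close>.\<close>

lemma s_squared_cong_c: "rat_cong (s ^ 2) c p 2"
  unfolding s_eq_prod c_eq_prod prod_power_distrib
proof (rule rat_cong_prod[OF p])
  fix i assume i: "i \<in> {1..m}"
  have "p_integral p ((1 / of_nat (2 * i)) ^ 2)"
    using i by (intro integral_intros integral_divide not_dvd) (auto simp: p_eq)
  moreover have "(1 - of_nat p / (2 * of_nat i)) ^ 2 - (1 - of_nat p / of_nat i) =
      of_nat p ^ 2 * (1 / of_nat (2 * i) :: rat) ^ 2"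
    using i by (simp add: field_simps power2_eq_square)
  ultimately show "rat_cong ((1 - of_nat p / (2 * of_nat i)) ^ 2) (1 - of_nat p / of_nat i) p 2"
    by (intro congI)
qed (auto intro!: factor_double_integral factor_integral p_integral_power[OF p])

lemma u_nz: "u \<noteq> 0"
  by (simp add: u_def)

lemma c_nz: "c \<noteq> 0"
  by (simp add: c_def)

lemma inverse_u_integral: "p_integral p (1 / u)"
  using integral_divide[OF integral_intros(4) not_dvd_power[OF not_dvd_power[OF not_dvd_2, of 2], of m]]
  by (simp add: u_def)

lemma u_integral: "p_integral p u"
  using integral_intros(2)[of "4 ^ m"] by (simp add: u_def)

lemma s_integral: "p_integral p s"
  using p_integral_of_rat_cong[OF p s_cong_1 p_integral_1[OF p]] .

text \<open>The central binomial divides \<open>(2m)! = (p-1)!\<close>, which is prime to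
  \<open>p\<close>.\<close>

lemma inverse_c_integral: "p_integral p (1 / c)"
proof -
  have "(2 * m choose m) * (fact m * fact m) = fact (2 * m)"
    using binomial_fact_lemma[of m "2 * m"] by (simp add: mult_ac)
  moreover have "\<not> p dvd fact (2 * m)"
    by (rule not_dvd_fact) (simp add: p_eq)
  ultimately have "\<not> p dvd (2 * m choose m)"
    by (metis dvd_mult2)
  then have "p_integral p ((-1) ^ m * (1 / of_nat (2 * m choose m)))"
    by (intro integral_intros integral_divide)
  moreover have "(-1) ^ m * (1 / of_nat (2 * m choose m)) = 1 / c"
    by (simp add: c_def field_simps flip: power_mult_distrib)
  ultimately show ?thesis by simp
qed

lemma inverse_s_integral: "p_integral p (1 / s)"
  using p_integral_mult[OF p u_integral inverse_c_integral] by (simp add: s_def)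

text \<open>Equivalent to Fermat's \<open>2^(p-1) = 1\<close> modulo \<open>p\<close>, here read off
  from \<open>1/u = s/c\<close> with \<open>s\<close> and \<open>c\<close> both 1 modulo
  \<open>p\<close>.\<close>

lemma inverse_u_cong_1: "rat_cong (1 / u) 1 p 1"
proof -
  obtain x y where x: "s - 1 = of_nat p ^ 1 * x" "p_integral p x" and y: "c - 1 = of_nat p ^ 1 * y" "p_integral p y"
    using s_cong_1 c_cong_1 unfolding rat_cong_iff by blast
  have "1 / u - 1 = (s - c) * (1 / c)"
    using u_nz c_nz by (simp add: s_def field_simps)
  also have "s - c = (s - 1) - (c - 1)"
    by simp
  also have "\<dots> * (1 / c) = of_nat p ^ 1 * ((x - y) * (1 / c))"
    unfolding x y by (simp only: power_one_right mult.assoc right_diff_distrib[symmetric])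
  finally show ?thesis
    by (rule congI) (intro integral_intros x y inverse_c_integral)
qed

text \<open>Babbage's congruence, as \<open>b\<close> is \<open>(2p-1 choose p-1)\<close>. In the
  sum of the squares of \<open>p choose k\<close>, the two ends give 2 and all other terms are
  divisible by \<open>p^2\<close>.\<close>

lemma b_cong_1: "rat_cong b 1 p 2"
proof -
  have "p > 0" by (simp add: p_eq)
  have "p ^ 2 dvd (\<Sum>k=1..<p. (p choose k)\<^sup>2)"
    using p by (intro dvd_sum) (auto intro!: dvd_power_same dvd_choose_prime)
  then obtain q where q: "(\<Sum>k=1..<p. (p choose k)\<^sup>2) = p ^ 2 * q" by blast
  have "2 * p choose p = (\<Sum>k\<le>p. (p choose k)\<^sup>2)"
    by (simp add: choose_square_sum)
  also have "{..p} = insert 0 (insert p {1..<p})"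
    using \<open>p > 0\<close> by auto
  also have "(\<Sum>k\<in>\<dots>. (p choose k)\<^sup>2) = 2 + p ^ 2 * q"
    using \<open>p > 0\<close> q by simp
  finally have "b - 1 = of_nat p ^ 2 * (of_nat q / of_nat 2 :: rat)"
    by (simp add: b_def add_divide_distrib)
  then show ?thesis
    by (rule congI) (intro integral_divide integral_intros not_dvd_2)
qed

lemma b_integral: "p_integral p b"
  using p_integral_of_rat_cong[OF p b_cong_1 p_integral_1[OF p]] .

lemma bracket_cong_1: "rat_cong (b ^ 2 * (s ^ 3 / c) + (1 / s - 1)) 1 p 2"
proof -
  obtain x where x: "b - 1 = of_nat p ^ 2 * x" "p_integral p x"
    using b_cong_1 unfolding rat_cong_iff by blast
  obtain y where y: "s ^ 2 - c = of_nat p ^ 2 * y" "p_integral p y"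
    using s_squared_cong_c unfolding rat_cong_iff by blast
  obtain z where z: "s - 1 = of_nat p ^ 1 * z" "p_integral p z"
    using s_cong_1 unfolding rat_cong_iff by blast
  have s_nz: "s \<noteq> 0" using u_nz c_nz by (simp add: s_def)
  \<comment> \<open>Replacing \<open>b\<close> by 1 and \<open>s ^ 2\<close> by \<open>c\<close>
    leaves \<open>s + 1/s - 2 = (s-1)^2/s\<close>, which is of second order in
    \<open>p\<close>.\<close>
  have "b ^ 2 * (s ^ 3 / c) + (1 / s - 1) - 1 =
      (b - 1) * ((b + 1) * s ^ 3 * (1 / c)) + (s ^ 2 - c) * (s * (1 / c)) + (s - 1) ^ 2 * (1 / s)"
    using s_nz c_nz by (simp add: field_simps power2_eq_square power3_eq_cube)
  also have "\<dots> = of_nat p ^ 2 * (x * ((b + 1) * s ^ 3 * (1 / c)) + y * (s * (1 / c)) + z ^ 2 * (1 / s))"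
    unfolding x y z by (simp add: algebra_simps power2_eq_square)
  finally show ?thesis
    by (rule congI)
      (intro integral_intros x y z b_integral s_integral inverse_c_integral inverse_s_integral)
qed

section \<open>The terms of the single sum, with one factor \<open>p\<close> removed\<close>

definition reduced_term :: "nat \<Rightarrow> rat" where "reduced_term j = scaled_term p j / of_nat p"

lemma p_nz: "(of_nat p :: rat) \<noteq> 0"
  by (simp add: p_eq flip: of_nat_Suc)

text \<open>Both sides are 1 at \<open>j = 0\<close>, and modulo \<open>p\<close> both have the
  ratio \<open>(2j+1) / (2(j+1))\<close> from \<open>j\<close> to \<open>j + 1\<close>.\<close>

lemma reduced_term_cong_choose: "j \<le> m \<Longrightarrow> rat_cong (reduced_term j) ((-1) ^ j * of_nat (m choose j)) p 1"
proof (induction j)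
  case 0
  then show ?case using p_nz by (simp add: reduced_term_def scaled_term_0 rat_cong_refl[OF p])
next
  case (Suc j)
  define J P where "J = (of_nat j :: rat)" "P = (of_nat p :: rat)"
  define f where "f = (P - J - 1) * (P + 2 * J + 1) * (P + 2 * J + 2) * (1 / of_nat (4 * Suc j ^ 3))"
  define g where "g = (P - 2 * J - 1) * (1 / of_nat (2 * Suc j))"
  have J: "J + 1 \<noteq> 0" unfolding J_P_def by (metis of_nat_Suc of_nat_neq_0 add.commute)
  have reduced_term: "reduced_term (Suc j) = (- 1) * f * reduced_term j"
    unfolding reduced_term_def scaled_term_Suc f_def J_P_def by (simp add: add.commute)
  have "of_nat (m choose Suc j) = g * of_nat (m choose j)"
  proof -
    have "Suc j * (m choose Suc j) = (m - j) * (m choose j)"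
      by (metis binomial_absorb_comp binomial_absorption)
    then have "of_nat (Suc j * (m choose Suc j)) = (of_nat ((m - j) * (m choose j)) :: rat)"
      by (simp only:)
    then have "(J + 1) * of_nat (m choose Suc j) = (of_nat m - J) * of_nat (m choose j)"
      using Suc.prems by (simp add: of_nat_diff J_P_def algebra_simps)
    then show ?thesis
      using J unfolding g_def by (simp add: J_P_def p_eq field_simps)
  qed
  then have C: "(-1) ^ Suc j * of_nat (m choose Suc j) = (- 1) * g * ((-1) ^ j * of_nat (m choose j))"
    by simp
  have "\<not> p dvd Suc j"
    using Suc.prems by (intro not_dvd) (auto simp: p_eq)
  then have nd: "\<not> p dvd 4 * Suc j ^ 3" "\<not> p dvd 2 * Suc j"
    using not_dvd_mult[OF not_dvd_power[OF not_dvd_2, of 2] not_dvd_power[of "Suc j" 3]]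
      not_dvd_mult[OF not_dvd_2, of "Suc j"] by simp_all
  note int = integral_divide[OF p_integral_1[OF p]]
  have fi: "p_integral p f" and gi: "p_integral p g"
    unfolding f_def g_def J_P_def
    by (intro integral_intros int nd)+
  have "rat_cong f g p 1"
  proof (rule congI)
    \<comment> \<open>Here \<open>a\<close> is \<open>J + 1\<close> and \<open>d\<close> is
      \<open>2 * J + 1\<close>; the point is the explicit factor \<open>P\<close> of the
      difference.\<close>
    have alg: "(P - a) * (P + d) * (P + 2 * a) * (1 / (4 * a ^ 3)) - (P - d) * (1 / (2 * a)) =
        P * ((P ^ 2 + (d + a) * P + a * d - 4 * a ^ 2) * (1 / (4 * a ^ 3)))"
      if "a \<noteq> 0" for a d :: rat
      using that by (simp add: field_simps power2_eq_square power3_eq_cube)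
    show "f - g = of_nat p ^ 1 * ((P ^ 2 + (2 * J + 1 + (J + 1)) * P + (J + 1) * (2 * J + 1) - 4 * (J + 1) ^ 2) *
        (1 / of_nat (4 * Suc j ^ 3)))"
      using alg[OF J, of "2 * J + 1"] by (simp add: f_def g_def J_P_def algebra_simps)
    show "p_integral p ((P ^ 2 + (2 * J + 1 + (J + 1)) * P + (J + 1) * (2 * J + 1) - 4 * (J + 1) ^ 2) *
        (1 / of_nat (4 * Suc j ^ 3)))"
      unfolding J_P_def
      by (intro integral_intros int nd)
  qed
  then have "rat_cong (- 1 * f) (- 1 * g) p 1"
    by (intro rat_cong_mult_left[OF p] integral_intros)
  then show ?case
    unfolding reduced_term C by (rule cong_mult) (use Suc in simp, intro integral_intros fi, intro integral_intros)
qed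

lemma reduced_term_integral: "j \<le> m \<Longrightarrow> p_integral p (reduced_term j)"
  by (rule p_integral_of_rat_cong[OF p reduced_term_cong_choose]) (assumption, intro integral_intros)

text \<open>At \<open>j = m\<close> the denominator \<open>2j+1\<close> equals \<open>p\<close> and
  costs one power of it, so a residue modulo \<open>p\<close> is too weak and the exact value is
  computed.\<close>

lemma reduced_term_middle: "reduced_term m = (-1) ^ m * b * c ^ 2 / u"
proof -
  define F where "F = (fact m :: rat)"
  have F: "F \<noteq> 0" by (simp add: F_def)
  have C: "of_nat (2 * m choose m) = fact (p - 1) / F ^ 2"
    using binomial_fact[of m "2 * m", where 'a=rat] by (simp add: p_eq F_def power2_eq_square)
  have "fact (2 * p) = 2 * of_nat p * (fact (2 * p - 1) :: rat)"
    using fact_reduce[of "2 * p", where 'a=rat] by (simp add: p_eq)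
  moreover have "fact p = of_nat p * (fact (p - 1) :: rat)"
    using fact_reduce[of p, where 'a=rat] by (simp add: p_eq)
  moreover have "of_nat (2 * p choose p) * (fact p * fact p) = (fact (2 * p) :: rat)"
    using binomial_fact[of p "2 * p", where 'a=rat] by simp
  ultimately have "fact (2 * p - 1) = of_nat p * b * fact (p - 1) ^ 2"
    using p_nz by (simp add: b_def power2_eq_square field_simps)
  \<comment> \<open>At \<open>j = m\<close>, \<open>p + 2j = 2p - 1\<close> and
    \<open>p - 1 - j = m\<close>, hence a fourth factor \<open>m!\<close>.\<close>
  moreover have "scaled_term p m * (F ^ 4 * (-4) ^ m) = fact (2 * p - 1)"
    using scaled_term_fact[of m p] by (simp add: p_eq F_def eval_nat_numeral mult_ac)
  ultimately have "reduced_term m * F ^ 4 * (-4) ^ m = b * fact (p - 1) ^ 2"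
    using p_nz by (simp add: reduced_term_def mult_ac)
  then have "reduced_term m = b * (fact (p - 1) / F ^ 2) ^ 2 / (-4) ^ m"
    using F by (simp add: power_divide field_simps)
  also have "\<dots> = b * c ^ 2 / (-4) ^ m"
    unfolding C[symmetric] by (simp add: c_def power_mult_distrib flip: power_mult)
  also have "\<dots> = (-1) ^ m * b * c ^ 2 / u"
  proof -
    have "(-4) ^ m * (-1) ^ m = u" by (simp add: u_def flip: power_mult_distrib)
    then show ?thesis by (cases "even m") auto
  qed
  finally show ?thesis .
qed

text \<open>Now \<open>p + 2j > 2p\<close>, so \<open>(p+2j)!\<close> contains \<open>p^2\<close>,
  while the denominator has only factorials of numbers below \<open>p\<close> and a power of
  4.\<close>

lemma reduced_term_large:
  assumes "m < j" "j < p"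
  shows "rat_cong (reduced_term j) 0 p 1"
proof -
  have "fact p * fact p dvd (fact (2 * p) :: nat)"
    using fact_fact_dvd_fact[of p p] by (simp add: mult_2)
  moreover have "fact (2 * p) dvd (fact (p + 2 * j) :: nat)"
    using assms by (intro fact_dvd) (simp add: p_eq)
  moreover have "p dvd fact p"
    using p by (simp add: dvd_fact prime_gt_0_nat Suc_leI)
  ultimately have "p * p dvd fact (p + 2 * j)"
    using dvd_trans mult_dvd_mono by metis
  then obtain q where q: "fact (p + 2 * j) = p * p * q" by blast
  define d :: nat where "d = fact (p - 1 - j) * fact j ^ 3 * 4 ^ j"
  have "\<not> p dvd 4"
    using not_dvd_power[OF not_dvd_2, of 2] by simp
  then have d: "\<not> p dvd d"
    unfolding d_def using assms by (intro not_dvd_mult not_dvd_power not_dvd_fact) auto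
  have "of_nat d \<noteq> (0 :: rat)"
    by (simp add: d_def)
  have "scaled_term p j * ((-1) ^ j * of_nat d) = of_nat (p * p * q)"
    unfolding q[symmetric] using scaled_term_fact[OF assms(2)] by (simp add: d_def power_minus[of 4] mult_ac)
  then have "reduced_term j * ((-1) ^ j * of_nat d) = of_nat p * of_nat q"
    using p_nz by (simp add: reduced_term_def field_simps)
  then have "reduced_term j - 0 = of_nat p ^ 1 * ((-1) ^ j * of_nat q / of_nat d)"
    using \<open>of_nat d \<noteq> 0\<close> by (cases "even j") (simp_all add: field_simps)
  then show ?thesis
    by (rule congI) (intro integral_intros integral_divide d)
qed

lemma franel_sum_cong:
  "rat_cong (\<Sum>k<p. (3 * of_nat k + 1) / (-16) ^ k * of_nat (2 * k choose k) * of_nat (franel k))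
     (of_nat p * (-1) ^ m) p 3"
proof -
  define P where "P = (of_nat p :: rat)"
  \<comment> \<open>Because \<open>4^p = 4 u^2\<close>, the prefactor
    \<open>2p (2p choose p) / 4^p\<close> of the single sum equals \<open>p w\<close>.\<close>
  define w where "w = b * (1 / u) ^ 2"
  define t where "t j = w * reduced_term j * (1 / of_nat (2 * j + 1))" for j
  define a :: "nat \<Rightarrow> rat" where "a j = (-1) ^ j * of_nat (m choose j) * (1 / of_nat (2 * j + 1))" for j
  have P: "P \<noteq> 0" "P = of_nat (2 * m + 1)" using p_nz by (simp_all add: P_def p_eq)
  have w_int: "p_integral p w"
    unfolding w_def by (intro integral_intros b_integral inverse_u_integral)
  have b1: "rat_cong b 1 p 1"
  proof -
    obtain x where "b - 1 = of_nat p ^ 2 * x" "p_integral p x"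
      using b_cong_1 unfolding rat_cong_iff by blast
    then show ?thesis
      by (intro congI[of _ _ _ "of_nat p * x"]) (auto simp: power2_eq_square intro!: integral_intros)
  qed
  have "rat_cong w (1 * (1 * 1)) p 1"
    unfolding w_def power2_eq_square
    by (intro cong_mult b1 inverse_u_cong_1 b_integral inverse_u_integral integral_intros)
  then have w1: "rat_cong w 1 p 1" by simp

  have "(\<Sum>k<p. (3 * of_nat k + 1) / (-16) ^ k * of_nat (2 * k choose k) * of_nat (franel k)) =
      (\<Sum>j<p. P ^ 2 * t j)"
    unfolding franel_sum_eq_scaled_term_sum
  proof (intro sum.cong refl)
    fix j
    have "(4 :: rat) ^ p = 4 * u ^ 2"
      by (simp add: p_eq u_def power_mult mult.commute[of 2 m])
    moreover have "scaled_term p j = P * reduced_term j"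
      using p_nz by (simp add: reduced_term_def P_def)
    ultimately show "2 * of_nat p * of_nat (2 * p choose p) / 4 ^ p * scaled_term p j / (2 * of_nat j + 1) = P ^ 2 * t j"
      by (simp add: t_def w_def b_def P_def power2_eq_square mult_ac add.commute)
  qed
  \<comment> \<open>Only \<open>j = m\<close> has \<open>2j+1\<close> divisible by \<open>p\<close>.
    The other terms may be reduced modulo \<open>p\<close> thanks to \<open>P ^ 2\<close>; this one
    is kept exact.\<close>
  also have "\<dots> = (\<Sum>j<m. P ^ 2 * t j) + (P ^ 2 * t m + (\<Sum>j\<in>{m<..<p}. P ^ 2 * t j))"
  proof -
    have "{..<p} = {..<m} \<union> insert m {m<..<p}"
      by (auto simp: p_eq)
    moreover have "{..<m} \<inter> insert m {m<..<p} = {}"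
      by auto
    ultimately show ?thesis
      by (simp add: sum.union_disjoint)
  qed
  finally have split: "(\<Sum>k<p. (3 * of_nat k + 1) / (-16) ^ k * of_nat (2 * k choose k) * of_nat (franel k)) = \<dots>" .

  have "rat_cong (\<Sum>j<m. P ^ 2 * t j) (\<Sum>j<m. P ^ 2 * a j) p (2 + 1)"
  proof (intro rat_cong_sum[OF p])
    fix j assume "j \<in> {..<m}"
    then have j: "j \<le> m" "\<not> p dvd 2 * j + 1" using not_dvd[of "2 * j + 1"] by (simp_all add: p_eq)
    have "rat_cong (t j) (1 * ((-1) ^ j * of_nat (m choose j)) * (1 / of_nat (2 * j + 1))) p 1"
      unfolding t_def
      by (intro cong_mult rat_cong_refl[OF p] w1 reduced_term_cong_choose integral_intros w_int reduced_term_integral j integral_divide)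
    then show "rat_cong (P ^ 2 * t j) (P ^ 2 * a j) p (2 + 1)"
      unfolding P_def a_def by (intro rat_cong_p_power_mult[OF p]) simp
  qed
  moreover have "rat_cong (\<Sum>j\<in>{m<..<p}. P ^ 2 * t j) (\<Sum>j\<in>{m<..<p}. P ^ 2 * 0) p (2 + 1)"
  proof (intro rat_cong_sum[OF p])
    fix j assume j: "j \<in> {m<..<p}"
    \<comment> \<open>For \<open>m < j < p\<close>, \<open>2j+1\<close> lies strictly between
      \<open>p\<close> and \<open>2p\<close>.\<close>
    have nd: "\<not> p dvd 2 * j + 1"
    proof
      assume "p dvd 2 * j + 1"
      then obtain k where k: "2 * j + 1 = p * k" by blast
      have "p * 1 < p * k" "p * k < p * 2" using j k by (auto simp: p_eq)
      then show False by simp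
    qed
    have "rat_cong (w * (1 / of_nat (2 * j + 1)) * reduced_term j) (w * (1 / of_nat (2 * j + 1)) * 0) p 1"
      using j nd by (intro rat_cong_mult_left[OF p] reduced_term_large integral_intros w_int integral_divide) auto
    then have "rat_cong (t j) 0 p 1"
      by (simp add: t_def)
    then show "rat_cong (P ^ 2 * t j) (P ^ 2 * 0) p (2 + 1)"
      unfolding P_def by (intro rat_cong_p_power_mult[OF p])
  qed
  ultimately have split_cong: "rat_cong ((\<Sum>j<m. P ^ 2 * t j) + (P ^ 2 * t m + (\<Sum>j\<in>{m<..<p}. P ^ 2 * t j)))
      ((\<Sum>j<m. P ^ 2 * a j) + (P ^ 2 * t m + (\<Sum>j\<in>{m<..<p}. P ^ 2 * 0))) p (2 + 1)"
    by (intro rat_cong_add[OF p] rat_cong_refl[OF p])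
  have total: "(\<Sum>j<m. P ^ 2 * a j) + (P ^ 2 * t m + (\<Sum>j\<in>{m<..<p}. P ^ 2 * 0)) =
      P ^ 1 * ((-1) ^ m * (b ^ 2 * (s ^ 3 / c) + (1 / s - 1)))"
  proof -
    have sq: "(-1 :: rat) ^ m * (-1) ^ m = 1" by (simp flip: power_mult_distrib)
    \<comment> \<open>The closed form covers \<open>j \<le> m\<close>; removing
      \<open>a m = (-1)^m / p\<close> produces the \<open>-1\<close> in the bracket.\<close>
    have "(\<Sum>j<m. a j) + a m = (\<Sum>j\<le>m. a j)"
      by (simp flip: lessThan_Suc_atMost)
    also have "\<dots> = u / (P * of_nat (2 * m choose m))"
      using alternating_binomial_sum_odd[of m] by (simp add: a_def u_def P(2) add.commute)
    also have "\<dots> = (-1) ^ m * (1 / s) / P"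
      using sq by (simp add: s_def c_def field_simps)
    also have "a m = (-1) ^ m / P"
      by (simp add: a_def P(2))
    finally have "(\<Sum>j<m. a j) = (-1) ^ m * (1 / s - 1) / P"
      by (simp add: right_diff_distrib diff_divide_distrib eq_diff_eq)
    then have sum_a: "(\<Sum>j<m. P ^ 2 * a j) = P * ((-1) ^ m * (1 / s - 1))"
      unfolding sum_distrib_left[symmetric] using P(1) by (simp add: power2_eq_square)
    have "P ^ 2 * t m = P * (w * reduced_term m)"
      using P(1) unfolding t_def P(2)[symmetric] by (simp add: power2_eq_square)
    \<comment> \<open>By the exact middle value this is \<open>(-1)^m b^2 c^2 / u^3\<close>, and
      \<open>c^2 / u^3 = s^3 / c\<close>.\<close>
    also have "w * reduced_term m = (-1) ^ m * (b ^ 2 * (s ^ 3 / c))"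
      using u_nz c_nz by (simp add: w_def reduced_term_middle s_def field_simps power2_eq_square power3_eq_cube)
    finally show ?thesis
      unfolding sum_a by (simp add: algebra_simps)
  qed
  have total_cong: "rat_cong (P ^ 1 * ((-1) ^ m * (b ^ 2 * (s ^ 3 / c) + (1 / s - 1)))) (P ^ 1 * ((-1) ^ m * 1)) p (1 + 2)"
    unfolding P_def
    by (intro rat_cong_p_power_mult[OF p] rat_cong_mult_left[OF p] bracket_cong_1 integral_intros)
  have "2 + 1 = (3 :: nat)" "1 + 2 = (3 :: nat)" by simp_all
  note three = this
  show ?thesis
    unfolding split using cong_trans[OF split_cong[unfolded total three] total_cong[unfolded three]]
    by (simp add: P_def)
qed

end

theorem theorem1p2:
  fixes p :: nat
  assumes "prime p" and "odd p"
  shows "rat_cong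
           (\<Sum>k\<le>p - 1. (3 * of_nat k + 1) / (-16) ^ k * of_nat (2 * k choose k) * of_nat (franel k))
           (of_nat p * (-1) ^ ((p - 1) div 2)) p 3"
proof -
  interpret odd_prime p "(p - 1) div 2"
    using assms by unfold_locales (auto elim: oddE)
  have "{..p - 1} = {..<p}"
    using prime_gt_0_nat[OF assms(1)] by auto
  then show ?thesis
    using franel_sum_cong by simp
qed

end
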